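(* (1) If $\mathbb{H}_0(\Omega)\subset\Omega$, then, for any $x\in\mathbb{F}_q$, there is an automorphism $\phi$ of $\Gamma(\Omega,q)$ such that $(\phi([l]))_*=l_*$ for all $[l]\in L(\Omega)$ and $(\phi(\langle r\rangle))_*=r_*+x$ for all $\langle r\rangle\in R(\Omega)$. (2) If $\mathbb{H}_1(\Omega)\subset\Omega$, then, for any $x\in\mathbb{F}_q$, there is an automorphism $\psi$ of $\Gamma(\Omega,q)$ such that $(\psi([l]))_*=l_*+x$ for all $[l]\in L(\Omega)$ and $(\psi(\langle r\rangle))_*=r_*$ for all $\langle r\rangle\in R(\Omega)$.
   Context: Let $q$ be a prime power and $\mathbb{F}_q$ the field with $q$ elements. $\{0,1\}^*$ is the set of finite binary sequences, $\eta$ the null sequence; juxtaposition is concatenation. $\Omega\subset\{0,1\}^*$ is a finite set satisfying condition C1: $\eta\in\Omega$, and for any $\alpha\in\Omega\setminus\{\eta\}$ the sequence obtained by deleting the last bit of $\alpha$ is in $\Omega$. $L(\Omega)$ and $R(\Omega)$ are two disjoint copies of $\mathbb{F}_q^{|\Omega|+1}$; their vectors are written $[l]$ and $\langle r\rangle$ respectively, with entries indexed by $\Omega\cup\{*\}$, where $*\notin\Omega$ is an extra symbol. $\Gamma(\Omega,q)$ is the bipartite graph with vertex set $L(\Omega)\cup R(\Omega)$ in which $[l]\in L(\Omega)$ and $\langle r\rangle\in R(\Omega)$ are adjacent if and only if $l_\eta+r_\eta=l_*r_*$, $l_{\alpha0}+r_{\alpha0}=r_*l_\alpha$ for all $\alpha0\in\Omega$,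 and $l_{\beta1}+r_{\beta1}=l_*r_\beta$ for all $\beta1\in\Omega$ (here $\alpha,\beta\in\{0,1\}^*$). The automorphisms map $L(\Omega)$ to $L(\Omega)$ and $R(\Omega)$ to $R(\Omega)$. For $a\in\{0,1\}$, $\mathbb{H}_a(\Omega)$ is the set of all binary sequences obtained from sequences in $\Omega$ by a finite number (possibly zero) of iterated deletions, each of which deletes a symbol $a$ either from the first position (when the first bit is $a$) or from two consecutive $a$'s (replacing some block $aa$ by $a$). *)

theory Defs
  imports "HOL-Library.FuncSet"
begin

text \<open>
  Binary sequences are lists of type \<open>bool list\<close>: the bit 0 is \<^term>\<open>False\<close>, the bit 1 is
  \<^term>\<open>True\<close>, and the last bit of a sequence is the last list element.
\<close>

definition C1 :: "bool list set \<Rightarrow> bool" where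
  "C1 \<Omega> \<longleftrightarrow> [] \<in> \<Omega> \<and> (\<forall>\<alpha> \<in> \<Omega> - {[]}. butlast \<alpha> \<in> \<Omega>)"

datatype index = Star | Seq "bool list"

text \<open>
  A vector over the field \<open>'a\<close> indexed by \<open>\<Omega> \<union> {*}\<close> is a function on \<^typ>\<open>index\<close> that is
  \<^term>\<open>undefined\<close> outside this index set.
\<close>

definition vectors :: "bool list set \<Rightarrow> (index \<Rightarrow> 'a) set" where
  "vectors \<Omega> = insert Star (Seq ` \<Omega>) \<rightarrow>\<^sub>E UNIV"

datatype 'a vertex = LVec "index \<Rightarrow> 'a" | RVec "index \<Rightarrow> 'a"

fun entry :: "'a vertex \<Rightarrow> index \<Rightarrow> 'a" where
  "entry (LVec l) i = l i"
| "entry (RVec r) i = r i"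

definition L_part :: "bool list set \<Rightarrow> 'a vertex set" where
  "L_part \<Omega> = LVec ` vectors \<Omega>"

definition R_part :: "bool list set \<Rightarrow> 'a vertex set" where
  "R_part \<Omega> = RVec ` vectors \<Omega>"

definition incident :: "bool list set \<Rightarrow> (index \<Rightarrow> 'a::field) \<Rightarrow> (index \<Rightarrow> 'a) \<Rightarrow> bool" where
  "incident \<Omega> l r \<longleftrightarrow>
     l (Seq []) + r (Seq []) = l Star * r Star \<and>
     (\<forall>\<alpha>. \<alpha> @ [False] \<in> \<Omega> \<longrightarrow>
        l (Seq (\<alpha> @ [False])) + r (Seq (\<alpha> @ [False])) = r Star * l (Seq \<alpha>)) \<and>
     (\<forall>\<beta>. \<beta> @ [True] \<in> \<Omega> \<longrightarrow>
        l (Seq (\<beta> @ [True])) + r (Seq (\<beta> @ [True])) = l Star * r (Seq \<beta>))"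

definition Gamma_verts :: "bool list set \<Rightarrow> 'a vertex set" where
  "Gamma_verts \<Omega> = L_part \<Omega> \<union> R_part \<Omega>"

definition Gamma_edges :: "bool list set \<Rightarrow> 'a::field vertex set set" where
  "Gamma_edges \<Omega> =
     {{LVec l, RVec r} | l r. l \<in> vectors \<Omega> \<and> r \<in> vectors \<Omega> \<and> incident \<Omega> l r}"

definition graph_automorphism :: "'v set \<Rightarrow> 'v set set \<Rightarrow> ('v \<Rightarrow> 'v) \<Rightarrow> bool" where
  "graph_automorphism V E \<phi> \<longleftrightarrow>
     bij_betw \<phi> V V \<and> (\<forall>u \<in> V. \<forall>v \<in> V. {u, v} \<in> E \<longleftrightarrow> {\<phi> u, \<phi> v} \<in> E)"

text \<open>Automorphisms of the bipartite graph are required to preserve each of the two parts.\<close>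

definition Gamma_automorphism :: "bool list set \<Rightarrow> ('a::field vertex \<Rightarrow> 'a vertex) \<Rightarrow> bool" where
  "Gamma_automorphism \<Omega> \<phi> \<longleftrightarrow>
     graph_automorphism (Gamma_verts \<Omega>) (Gamma_edges \<Omega>) \<phi> \<and>
     \<phi> ` L_part \<Omega> = L_part \<Omega> \<and> \<phi> ` R_part \<Omega> = R_part \<Omega>"

inductive deletion :: "bool \<Rightarrow> bool list \<Rightarrow> bool list \<Rightarrow> bool" for a :: bool where
  first: "deletion a (a # w) w"
| block: "deletion a (u @ [a, a] @ w) (u @ [a] @ w)"

definition H :: "bool \<Rightarrow> bool list set \<Rightarrow> bool list set" where
  "H a \<Omega> = {\<beta>. \<exists>\<alpha> \<in> \<Omega>. (deletion a)\<^sup>*\<^sup>* \<alpha> \<beta>}"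

end

theory Submission
  imports Defs
begin

text \<open>
  Fix a bit \<open>a\<close> and call the part of the graph whose entry at \<open>\<alpha>\<close> occurs in the product on
  the right of the edge equation for \<open>\<alpha>a\<close> the \<open>a\<close>-side: this is \<open>L\<close> for \<open>a = 0\<close> and \<open>R\<close> for \<open>a = 1\<close>. The two claims are the
  same statement for the two values of \<open>a\<close>: the star entry of the \<open>a\<close>-side stays, that of the other
  side grows by \<open>x\<close>. For simplicity let \<open>a = 0\<close>.

  The new entries at words are sought as linear functions of the old entries. So look for linear
  operators \<open>T\<close>, \<open>S\<close> on formal combinations of words, extended by the symbol \<open>*\<close> with
  \<open>*0 = \<eta>\<close>, such that \<open>l'\<^sub>w = l(Tw)\<close> and \<open>r'\<^sub>w = r(Sw)\<close>. With the convention \<open>*0 = \<eta>\<close> the equation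
  for \<open>\<eta>\<close> becomes a case of the one for \<open>\<alpha>0\<close>. Along an edge, \<open>(r\<^sub>* + x) l(Tw)\<close> equals
  \<open>l((Tw)0) + r((Tw)0) + x l(Tw)\<close>, and \<open>l\<^sub>* r(Sw)\<close> equals \<open>l((Sw)1) + r((Sw)1)\<close>, so that the new
  pair is again an edge if
    \<open>T(w0) = (Tw)0 + x Tw\<close>, \<open>S(w0) = (Tw)0\<close>, \<open>T(w1) = S(w1) = (Sw)1\<close>,
  starting from \<open>T* = *\<close>, that is \<open>T\<eta> = \<eta> + x*\<close> and \<open>S\<eta> = \<eta>\<close>.

  Two things have to be checked. First, every word that occurs must lie in \<open>\<Omega>\<close>. Here \<open>Sw\<close> and
  \<open>(Tw)0\<close> only involve words obtained from \<open>w\<close>, respectively \<open>w0\<close>, by removing zeros in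
  such a way that every block of zeros not at the beginning keeps at least one; this is what the
  deletions defining \<open>\<H>\<^sub>0\<close> achieve (lemma \<open>deletion_support\<close>). The words in \<open>Tw\<close> itself
  may in addition lose their last zeros, which C1 permits (lemma \<open>support_in_coords\<close>). Second, the map must be invertible: passing from \<open>w\<close> to
  \<open>w0\<close> applies the operator ``append 0, plus \<open>x\<close>'', so the maps for \<open>x\<close> and \<open>y\<close> compose to the map
  for \<open>x + y\<close> (lemma \<open>pull_shear\<close>) and the inverse belongs to \<open>-x\<close>.
\<close>

section \<open>The linear functionals behind the automorphism\<close>

text \<open>
  The value at \<open>Star\<close> is the convention that the star followed by \<open>a\<close> is the empty word. It is made
  for both bits since \<open>a\<close> may be either; for \<open>b \<noteq> a\<close> the operator \<open>S\<close>, which is free of the star,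
  precedes the appended bit.
\<close>
fun ext :: "bool \<Rightarrow> index \<Rightarrow> index" where
  "ext b Star = Seq []"
| "ext b (Seq w) = Seq (w @ [b])"

text \<open>
  This is \<open>f(Tw)\<close> if \<open>s\<close> holds and \<open>f(Sw)\<close> otherwise. The word is given in reverse because the
  recursion removes its last bit. Appending a bit to every word of a formal combination is expressed
  by composing the functional \<open>f\<close> with \<^term>\<open>ext b\<close>, so that no type of formal combinations is needed.
\<close>
primrec pull :: "bool \<Rightarrow> 'a \<Rightarrow> bool \<Rightarrow> bool list \<Rightarrow> (index \<Rightarrow> 'a::field) \<Rightarrow> 'a" where
  "pull a x s [] f = f (Seq []) + (if s then x * f Star else 0)"
| "pull a x s (b # w) f =
     (if b = a
      then pull a x True w (\<lambda>i. f (ext b i)) + (if s then x * pull a x True w f else 0)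
      else pull a x False w (\<lambda>i. f (ext b i)))"

text \<open>The indices at which \<^const>\<open>pull\<close> may inspect its functional.\<close>
primrec support :: "bool \<Rightarrow> bool \<Rightarrow> bool list \<Rightarrow> index set" where
  "support a s [] = insert (Seq []) (if s then {Star} else {})"
| "support a s (b # w) =
     (if b = a
      then ext b ` support a True w \<union> (if s then support a True w else {})
      else ext b ` support a False w)"

lemma pull_cong:
  assumes "\<And>i. i \<in> support a s w \<Longrightarrow> f i = g i"
  shows "pull a x s w f = pull a x s w g"
  using assms
proof (induction w arbitrary: s f g)
  case Nil
  then show ?case by auto
next
  case (Cons b w)
  show ?case
  proof (cases "b = a")
    case True
    have "pull a x True w (\<lambda>i. f (ext b i)) = pull a x True w (\<lambda>i. g (ext b i))"
      by (rule Cons.IH) (use Cons.prems True in auto)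
    moreover have "s \<Longrightarrow> pull a x True w f = pull a x True w g"
      by (rule Cons.IH) (use Cons.prems True in auto)
    ultimately show ?thesis using True by auto
  next
    case False
    have "pull a x False w (\<lambda>i. f (ext b i)) = pull a x False w (\<lambda>i. g (ext b i))"
      by (rule Cons.IH) (use Cons.prems False in auto)
    then show ?thesis using False by simp
  qed
qed

lemma pull_add: "pull a x s w (\<lambda>i. f i + g i) = pull a x s w f + pull a x s w g"
  by (induction w arbitrary: s f g) (auto simp: algebra_simps)

lemma pull_scale: "pull a x s w (\<lambda>i. c * f i) = c * pull a x s w f"
  by (induction w arbitrary: s f) (auto simp: algebra_simps)

lemma pull_zero: "pull a 0 s w f = f (Seq (rev w))"
  by (induction w arbitrary: s f) auto

lemma Star_notin_support: "Star \<notin> support a False w"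
proof -
  have "Star \<noteq> ext b i" for b i by (cases i) auto
  then show ?thesis by (cases w) auto
qed

text \<open>
  The transformed vector on the \<open>a\<close>-side (\<open>s\<close> holds) or on the other side, before its entries are
  restricted to the index set.
\<close>
definition shear :: "bool \<Rightarrow> 'a \<Rightarrow> bool \<Rightarrow> (index \<Rightarrow> 'a::field) \<Rightarrow> index \<Rightarrow> 'a" where
  "shear a x s f i =
     (case i of Star \<Rightarrow> f Star + (if s then 0 else x) | Seq w \<Rightarrow> pull a x s (rev w) f)"

lemma shear_simps [simp]:
  "shear a x s f Star = f Star + (if s then 0 else x)"
  "shear a x s f (Seq w) = pull a x s (rev w) f"
  by (simp_all add: shear_def)

lemma shear_ext_same:
  "shear a x s f (ext a i) =
     shear a x True (\<lambda>i. f (ext a i)) i + (if s then x * shear a x True f i else 0)"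
  by (cases i) auto

lemma shear_ext_other:
  assumes "b \<noteq> a" and "i \<noteq> Star"
  shows "shear a x s f (ext b i) = shear a x False (\<lambda>i. f (ext b i)) i"
  using assms by (cases i) auto

text \<open>
  The additive group acts: the operators \<open>u \<mapsto> ua + xu\<close> and \<open>u \<mapsto> ua + yu\<close> that build up the two maps
  combine to \<open>u \<mapsto> ua + (x + y)u\<close>.
\<close>
lemma pull_shear: "pull a y s w (shear a x s f) = pull a (x + y) s w f"
proof (induction w arbitrary: s f)
  case Nil
  show ?case by (simp add: algebra_simps)
next
  case (Cons b w)
  show ?case
  proof (cases "b = a")
    case True
    have "pull a y True w (\<lambda>i. shear a x s f (ext a i)) =
          pull a (x + y) True w (\<lambda>i. f (ext a i)) + (if s then x * pull a (x + y) True w f else 0)"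
      by (cases s) (simp_all add: shear_ext_same pull_add pull_scale Cons.IH)
    then show ?thesis
      using True by (cases s) (simp_all add: Cons.IH algebra_simps)
  next
    case False
    have "pull a y False w (\<lambda>i. shear a x s f (ext b i)) =
          pull a y False w (shear a x False (\<lambda>i. f (ext b i)))"
      by (rule pull_cong) (metis shear_ext_other False Star_notin_support)
    then show ?thesis using False by (simp add: Cons.IH)
  qed
qed

section \<open>Words reached by deletions\<close>

lemma deletion_snoc: "deletion a u v \<Longrightarrow> deletion a (u @ [b]) (v @ [b])"
proof (induction rule: deletion.induct)
  case (first w)
  show ?case using deletion.first[of a "w @ [b]"] by simp
next
  case (block u w)
  show ?case using deletion.block[of a u "w @ [b]"] by simp
qed

lemma deletions_snoc:
  "(deletion a)\<^sup>*\<^sup>* u v \<Longrightarrow> (deletion a)\<^sup>*\<^sup>* (u @ [b]) (v @ [b])"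
  by (induction rule: rtranclp_induct) (auto intro: deletion_snoc rtranclp.rtrancl_into_rtrancl)

text \<open>
  The words of \<open>Sw\<close> are reached from \<open>w\<close>. Those of \<open>Tw\<close> need not be, since \<open>T\<close> can remove a final
  block of \<open>a\<close> completely or even leave the star, but they are once \<open>a\<close> is appended: then one \<open>a\<close>
  of that block survives, and the star turns into the empty word, which is reached by deletions of
  a first symbol. Both assertions are proved together because \<open>T\<close> and \<open>S\<close> are mutually recursive.
\<close>
lemma deletion_support:
  "(i \<in> support a False w \<longrightarrow> (\<exists>u. i = Seq u \<and> (deletion a)\<^sup>*\<^sup>* (rev w) u)) \<and>
   (i \<in> support a True w \<longrightarrow> (\<exists>u. ext a i = Seq u \<and> (deletion a)\<^sup>*\<^sup>* (rev w @ [a]) u))"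
proof (induction w arbitrary: i)
  case Nil
  have "(deletion a)\<^sup>*\<^sup>* [a] []" using deletion.first[of a "[]"] by blast
  then show ?case by auto
next
  case (Cons b w)
  show ?case
  proof (cases "b = a")
    case True
    have appended: "\<exists>u. i = Seq u \<and> (deletion a)\<^sup>*\<^sup>* (rev w @ [a]) u"
      if "i \<in> ext a ` support a True w"
      using that Cons.IH by auto
    have "\<exists>u. ext a i = Seq u \<and> (deletion a)\<^sup>*\<^sup>* (rev w @ [a, a]) u"
      if "i \<in> support a True w"
    proof -
      have "deletion a (rev w @ [a, a]) (rev w @ [a])"
        using deletion.block[of a "rev w" "[]"] by simp
      then show ?thesis using Cons.IH that by (meson converse_rtranclp_into_rtranclp)
    qed
    moreover have "\<exists>u. ext a i = Seq u \<and> (deletion a)\<^sup>*\<^sup>* (rev w @ [a, a]) u"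
      if "i \<in> ext a ` support a True w"
      using appended[OF that] deletions_snoc[of a "rev w @ [a]" _ a] by fastforce
    ultimately show ?thesis using True appended by auto
  next
    case False
    have "\<exists>u. i = Seq u \<and> (deletion a)\<^sup>*\<^sup>* (rev w @ [b]) u" if "i \<in> ext b ` support a False w"
      using that Cons.IH deletions_snoc[of a "rev w" _ b] by fastforce
    moreover from this
    have "\<exists>u. ext a i = Seq u \<and> (deletion a)\<^sup>*\<^sup>* (rev w @ [b, a]) u"
      if "i \<in> ext b ` support a False w"
      using that deletions_snoc[of a "rev w @ [b]" _ a] by fastforce
    ultimately show ?thesis using False by auto
  qed
qed

definition coords :: "bool list set \<Rightarrow> index set" where
  "coords \<Omega> = insert Star (Seq ` \<Omega>)"

lemma vectors_coords: "vectors \<Omega> = coords \<Omega> \<rightarrow>\<^sub>E UNIV"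
  by (simp add: vectors_def coords_def)

lemma C1_snocD: "C1 \<Omega> \<Longrightarrow> w @ [b] \<in> \<Omega> \<Longrightarrow> w \<in> \<Omega>"
  unfolding C1_def by (metis Diff_iff butlast_snoc empty_iff insert_iff snoc_eq_iff_butlast)

lemma ext_support_in_coords:
  assumes H: "H a \<Omega> \<subseteq> \<Omega>"
  shows "i \<in> support a True w \<Longrightarrow> rev w @ [a] \<in> \<Omega> \<Longrightarrow> ext a i \<in> coords \<Omega>"
    and "i \<in> support a False w \<Longrightarrow> rev w \<in> \<Omega> \<Longrightarrow> i \<in> coords \<Omega>"
  using deletion_support[of i a w] H by (fastforce simp: H_def coords_def)+

lemma support_in_coords:
  assumes H: "H a \<Omega> \<subseteq> \<Omega>" and C1: "C1 \<Omega>"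
  shows "rev w \<in> \<Omega> \<Longrightarrow> support a s w \<subseteq> coords \<Omega>"
proof (induction w arbitrary: s)
  case Nil
  then show ?case by (auto simp: coords_def)
next
  case (Cons b w)
  \<comment> \<open>Only the terms of \<open>x Tw\<close> in \<open>T(wa)\<close> are not covered by deletions; here the prefix \<open>w\<close> is
      used.\<close>
  have "rev w \<in> \<Omega>" using Cons.prems C1_snocD[OF C1] by simp
  then have "support a True w \<subseteq> coords \<Omega>" by (rule Cons.IH)
  moreover have "support a False (b # w) \<subseteq> coords \<Omega>"
    using ext_support_in_coords(2)[OF H _ Cons.prems] by blast
  ultimately show ?case by (cases "b = a") (auto split: if_splits)
qed

section \<open>The edge equations are preserved\<close>

text \<open>
  The edge equations with the \<open>a\<close>-side in first place; complementing \<open>a\<close> exchanges the two parts of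
  the graph.
\<close>
definition edge :: "bool \<Rightarrow> bool list set \<Rightarrow> (index \<Rightarrow> 'a::field) \<Rightarrow> (index \<Rightarrow> 'a) \<Rightarrow> bool" where
  "edge a \<Omega> f g \<longleftrightarrow>
     f (Seq []) + g (Seq []) = f Star * g Star \<and>
     (\<forall>w. w @ [a] \<in> \<Omega> \<longrightarrow> f (Seq (w @ [a])) + g (Seq (w @ [a])) = g Star * f (Seq w)) \<and>
     (\<forall>w. w @ [\<not> a] \<in> \<Omega> \<longrightarrow> f (Seq (w @ [\<not> a])) + g (Seq (w @ [\<not> a])) = f Star * g (Seq w))"

lemma incident_edge:
  "incident \<Omega> l r \<longleftrightarrow> edge False \<Omega> l r"
  "incident \<Omega> l r \<longleftrightarrow> edge True \<Omega> r l"
  by (auto simp: incident_def edge_def algebra_simps)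

lemma edge_ext_same:
  assumes "edge a \<Omega> f g" and "ext a i \<in> coords \<Omega>"
  shows "f (ext a i) + g (ext a i) = g Star * f i"
  using assms by (cases i) (auto simp: edge_def coords_def algebra_simps)

lemma edge_ext_other:
  assumes "edge a \<Omega> f g" and "ext (\<not> a) i \<in> coords \<Omega>" and "i \<noteq> Star"
  shows "f (ext (\<not> a) i) + g (ext (\<not> a) i) = f Star * g i"
  using assms by (cases i) (auto simp: edge_def coords_def)

lemma edge_shear:
  assumes H: "H a \<Omega> \<subseteq> \<Omega>" and edge: "edge a \<Omega> f g"
  shows "edge a \<Omega> (shear a x True f) (shear a x False g)"
  unfolding edge_def
proof (intro conjI allI impI)
  have "f (Seq []) + g (Seq []) = f Star * g Star"
    using edge by (simp add: edge_def)
  then show "shear a x True f (Seq []) + shear a x False g (Seq []) =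
      shear a x True f Star * shear a x False g Star"
    by (simp add: algebra_simps)
next
  fix w assume "w @ [a] \<in> \<Omega>"
  then have "pull a x True (rev w) (\<lambda>i. f (ext a i) + g (ext a i)) =
      pull a x True (rev w) (\<lambda>i. g Star * f i)"
    using ext_support_in_coords(1)[OF H, of _ "rev w"]
    by (intro pull_cong edge_ext_same[OF edge]) simp
  then show "shear a x True f (Seq (w @ [a])) + shear a x False g (Seq (w @ [a])) =
      shear a x False g Star * shear a x True f (Seq w)"
    by (simp add: pull_add pull_scale) algebra
next
  fix w assume w: "w @ [\<not> a] \<in> \<Omega>"
  have "pull a x False (rev w) (\<lambda>i. f (ext (\<not> a) i) + g (ext (\<not> a) i)) =
      pull a x False (rev w) (\<lambda>i. f Star * g i)"
  proof (intro pull_cong edge_ext_other[OF edge])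
    fix i assume i: "i \<in> support a False (rev w)"
    then show "i \<noteq> Star" using Star_notin_support by metis
    show "ext (\<not> a) i \<in> coords \<Omega>"
      by (rule ext_support_in_coords(2)[OF H, of _ "(\<not> a) # rev w"]) (use i w in auto)
  qed
  then show "shear a x True f (Seq (w @ [\<not> a])) + shear a x False g (Seq (w @ [\<not> a])) =
      shear a x True f Star * shear a x False g (Seq w)"
    by (simp add: pull_add pull_scale)
qed

section \<open>The action on the vertices\<close>

definition act :: "bool list set \<Rightarrow> bool \<Rightarrow> 'a \<Rightarrow> bool \<Rightarrow> (index \<Rightarrow> 'a::field) \<Rightarrow> index \<Rightarrow> 'a" where
  "act \<Omega> a x s f = restrict (shear a x s f) (coords \<Omega>)"

lemma act_in_vectors: "act \<Omega> a x s f \<in> vectors \<Omega>"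
  by (simp add: act_def vectors_coords)

lemma act_Star: "act \<Omega> a x s f Star = f Star + (if s then 0 else x)"
  by (simp add: act_def coords_def)

lemma act_act:
  assumes H: "H a \<Omega> \<subseteq> \<Omega>" and C1: "C1 \<Omega>"
  shows "act \<Omega> a y s (act \<Omega> a x s f) = act \<Omega> a (x + y) s f"
proof
  fix i
  consider (star) "i = Star" | (word) w where "i = Seq w" "w \<in> \<Omega>" | (outside) "i \<notin> coords \<Omega>"
    by (auto simp: coords_def)
  then show "act \<Omega> a y s (act \<Omega> a x s f) i = act \<Omega> a (x + y) s f i"
  proof cases
    case star
    then show ?thesis by (simp add: act_Star)
  next
    case (word w)
    have "support a s (rev w) \<subseteq> coords \<Omega>"
      by (rule support_in_coords[OF H C1]) (simp add: word)
    then have "pull a y s (rev w) (act \<Omega> a x s f) = pull a y s (rev w) (shear a x s f)"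
      by (intro pull_cong) (auto simp: act_def)
    then show ?thesis
      using word by (simp add: act_def[of _ _ y] act_def[of _ _ "x + y"] coords_def pull_shear)
  next
    case outside
    then show ?thesis by (simp add: act_def)
  qed
qed

lemma act_zero:
  assumes "f \<in> vectors \<Omega>"
  shows "act \<Omega> a 0 s f = f"
proof -
  have "shear a 0 s f i = f i" for i
    by (cases i) (simp_all add: pull_zero)
  then have "shear a 0 s f = f" ..
  then show ?thesis
    using assms by (simp add: act_def vectors_coords)
qed

lemma act_minus:
  assumes "H a \<Omega> \<subseteq> \<Omega>" and "C1 \<Omega>" and "f \<in> vectors \<Omega>"
  shows "act \<Omega> a (- x) s (act \<Omega> a x s f) = f"
  using assms by (simp add: act_act act_zero)

lemma bij_betw_act:
  assumes "H a \<Omega> \<subseteq> \<Omega>" and "C1 \<Omega>"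
  shows "bij_betw (act \<Omega> a x s) (vectors \<Omega>) (vectors \<Omega>)"
proof (rule bij_betw_byWitness[where f' = "act \<Omega> a (- x) s"])
  show "\<forall>f\<in>vectors \<Omega>. act \<Omega> a (- x) s (act \<Omega> a x s f) = f"
    using act_minus[OF assms] by blast
  show "\<forall>f\<in>vectors \<Omega>. act \<Omega> a x s (act \<Omega> a (- x) s f) = f"
    using act_minus[OF assms, of _ "- x"] by simp
qed (auto simp: act_in_vectors)

lemma edge_act:
  assumes H: "H a \<Omega> \<subseteq> \<Omega>" and C1: "C1 \<Omega>" and "edge a \<Omega> f g"
  shows "edge a \<Omega> (act \<Omega> a x True f) (act \<Omega> a x False g)"
proof -
  have "edge a \<Omega> (shear a x True f) (shear a x False g)"
    using H assms(3) by (rule edge_shear)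
  moreover have "Seq [] \<in> coords \<Omega>" "Star \<in> coords \<Omega>"
    using C1 by (simp_all add: coords_def C1_def)
  moreover have "Seq (w @ [b]) \<in> coords \<Omega>" "Seq w \<in> coords \<Omega>" if "w @ [b] \<in> \<Omega>" for w b
    using that C1_snocD[OF C1 that] by (simp_all add: coords_def)
  ultimately show ?thesis
    unfolding edge_def act_def by (simp del: shear_simps)
qed

lemma edge_act_iff:
  assumes "H a \<Omega> \<subseteq> \<Omega>" and "C1 \<Omega>" and "f \<in> vectors \<Omega>" and "g \<in> vectors \<Omega>"
  shows "edge a \<Omega> (act \<Omega> a x True f) (act \<Omega> a x False g) \<longleftrightarrow> edge a \<Omega> f g"
  using edge_act[OF assms(1,2), of f g x]
    edge_act[OF assms(1,2), of "act \<Omega> a x True f" "act \<Omega> a x False g" "- x"]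
  by (auto simp: act_minus assms)

fun on_parts ::
  "((index \<Rightarrow> 'a) \<Rightarrow> index \<Rightarrow> 'a) \<Rightarrow> ((index \<Rightarrow> 'a) \<Rightarrow> index \<Rightarrow> 'a) \<Rightarrow> 'a vertex \<Rightarrow> 'a vertex"
where
  "on_parts F G (LVec l) = LVec (F l)"
| "on_parts F G (RVec r) = RVec (G r)"

lemma Gamma_edges_iff:
  "{LVec l, LVec l'} \<notin> Gamma_edges \<Omega>"
  "{RVec r, RVec r'} \<notin> Gamma_edges \<Omega>"
  "{LVec l, RVec r} \<in> Gamma_edges \<Omega> \<longleftrightarrow> l \<in> vectors \<Omega> \<and> r \<in> vectors \<Omega> \<and> incident \<Omega> l r"
  "{RVec r, LVec l} \<in> Gamma_edges \<Omega> \<longleftrightarrow> l \<in> vectors \<Omega> \<and> r \<in> vectors \<Omega> \<and> incident \<Omega> l r"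
  by (auto simp: Gamma_edges_def doubleton_eq_iff)

lemma Gamma_automorphism_on_parts:
  assumes F: "bij_betw F (vectors \<Omega>) (vectors \<Omega>)" and G: "bij_betw G (vectors \<Omega>) (vectors \<Omega>)"
    and inc: "\<And>l r. l \<in> vectors \<Omega> \<Longrightarrow> r \<in> vectors \<Omega> \<Longrightarrow>
      incident \<Omega> (F l) (G r) \<longleftrightarrow> incident \<Omega> l r"
  shows "Gamma_automorphism \<Omega> (on_parts F G)"
proof -
  let ?\<phi> = "on_parts F G"
  have L: "?\<phi> ` L_part \<Omega> = L_part \<Omega>"
    using bij_betw_imp_surj_on[OF F] by (force simp: L_part_def image_image)
  have R: "?\<phi> ` R_part \<Omega> = R_part \<Omega>"
    using bij_betw_imp_surj_on[OF G] by (force simp: R_part_def image_image)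
  have "inj_on ?\<phi> (Gamma_verts \<Omega>)"
    using inj_on_eq_iff[OF bij_betw_imp_inj_on[OF F]] inj_on_eq_iff[OF bij_betw_imp_inj_on[OF G]]
    by (auto intro!: inj_onI simp: Gamma_verts_def L_part_def R_part_def)
  then have "bij_betw ?\<phi> (Gamma_verts \<Omega>) (Gamma_verts \<Omega>)"
    using L R by (simp add: bij_betw_def Gamma_verts_def image_Un)
  moreover have "{u, v} \<in> Gamma_edges \<Omega> \<longleftrightarrow> {?\<phi> u, ?\<phi> v} \<in> Gamma_edges \<Omega>"
    if "u \<in> Gamma_verts \<Omega>" "v \<in> Gamma_verts \<Omega>" for u v
    using that inc bij_betwE[OF F] bij_betwE[OF G]
    by (auto simp: Gamma_verts_def L_part_def R_part_def Gamma_edges_iff)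
  ultimately show ?thesis
    using L R by (simp add: Gamma_automorphism_def graph_automorphism_def)
qed

theorem lemma4:
  fixes \<Omega> :: "bool list set"
  assumes "finite \<Omega>" and "C1 \<Omega>"
  shows "(H False \<Omega> \<subseteq> \<Omega> \<longrightarrow>
      (\<forall>x::'a::{field,finite}. \<exists>\<phi>. Gamma_automorphism \<Omega> \<phi> \<and>
        (\<forall>l \<in> vectors \<Omega>. entry (\<phi> (LVec l)) Star = l Star) \<and>
        (\<forall>r \<in> vectors \<Omega>. entry (\<phi> (RVec r)) Star = r Star + x)))
    \<and> (H True \<Omega> \<subseteq> \<Omega> \<longrightarrow>
      (\<forall>x::'a::{field,finite}. \<exists>\<psi>. Gamma_automorphism \<Omega> \<psi> \<and>
        (\<forall>l \<in> vectors \<Omega>. entry (\<psi> (LVec l)) Star = l Star + x) \<and>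
        (\<forall>r \<in> vectors \<Omega>. entry (\<psi> (RVec r)) Star = r Star)))"
proof (intro conjI impI allI)
  fix x :: 'a
  assume H: "H False \<Omega> \<subseteq> \<Omega>"
  let ?F = "act \<Omega> False x True" and ?G = "act \<Omega> False x False"
  have "Gamma_automorphism \<Omega> (on_parts ?F ?G)"
    using bij_betw_act[OF H assms(2)] edge_act_iff[OF H assms(2)]
    by (intro Gamma_automorphism_on_parts) (simp_all add: incident_edge(1))
  then show "\<exists>\<phi>. Gamma_automorphism \<Omega> \<phi> \<and>
      (\<forall>l \<in> vectors \<Omega>. entry (\<phi> (LVec l)) Star = l Star) \<and>
      (\<forall>r \<in> vectors \<Omega>. entry (\<phi> (RVec r)) Star = r Star + x)"
    by (intro exI[of _ "on_parts ?F ?G"]) (simp add: act_Star)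
next
  fix x :: 'a
  assume H: "H True \<Omega> \<subseteq> \<Omega>"
  let ?F = "act \<Omega> True x False" and ?G = "act \<Omega> True x True"
  have "Gamma_automorphism \<Omega> (on_parts ?F ?G)"
    using bij_betw_act[OF H assms(2)] edge_act_iff[OF H assms(2)]
    by (intro Gamma_automorphism_on_parts) (simp_all add: incident_edge(2))
  then show "\<exists>\<psi>. Gamma_automorphism \<Omega> \<psi> \<and>
      (\<forall>l \<in> vectors \<Omega>. entry (\<psi> (LVec l)) Star = l Star + x) \<and>
      (\<forall>r \<in> vectors \<Omega>. entry (\<psi> (RVec r)) Star = r Star)"
    by (intro exI[of _ "on_parts ?F ?G"]) (simp add: act_Star)
qed

end
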